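(* Let $z$, $u$ and $X=\{x_1,x_2,\ldots\}$ be independent indeterminates. For all integers $n,r\ge1$ one has $$\sum_{\mu\vdash n}\frac{(-1)^{r-l(\mu)}}{z_\mu}\left\langle{\mu\atop r}\right\rangle\prod_{i\ge1}\left(z+\sum_{k\ge1}u^k\frac{(i)_k}{k!}x_k\right)^{m_i(\mu)}=\sum_{j\ge0}u^j\binom{n+j-1}{n-r}\sum_{k=0}^{\min(r,j)}\binom{z-j}{r-k}\sum_{\mu\vdash j}\frac{\left\langle{\mu\atop k}\right\rangle}{z_\mu}\prod_{i\ge1}x_i^{m_i(\mu)},$$ as an identity of formal power series in $u$.
   Context: The letter $\mu$ denotes an integer partition; $|\mu|$ is the sum of its parts, $\mu\vdash n$ means $|\mu|=n$, $l(\mu)$ is its number of (nonzero) parts, $m_i(\mu)$ the number of parts equal to $i\ge1$, and $z_\mu=\prod_{i\ge1}i^{m_i(\mu)}m_i(\mu)!$ (a number, unrelated to the indeterminate $z$). The generalized binomial coefficient $\left\langle{\mu\atop k}\right\rangle$ (for an integer $k\ge0$) is the number of ways to choose $k$ cells in the Ferrers diagram of $\mu$ with at least one cell chosen in each row (so for the empty partition it is $1$ if $k=0$ and $0$ otherwise). $(a)_k=a(a+1)\cdots(a+k-1)$ is the rising factorial. $\binom{a}{m}=a(a-1)\cdots(a-m+1)/m!$ for an integer $m\ge0$ and $\binom{a}{m}=0$ for $m<0$. *)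

theory Defs
  imports
    "HOL-Library.Multiset"
    "HOL-Library.Poly_Mapping"
    "HOL-Computational_Algebra.Formal_Power_Series"
begin

text \<open>
  Polynomials over \<open>'a\<close> in countably many indeterminates: finitely supported maps from monomials
  (finitely supported exponent vectors) to coefficients, with convolution as multiplication.
\<close>

type_synonym 'a mpol = "(nat \<Rightarrow>\<^sub>0 nat) \<Rightarrow>\<^sub>0 'a"

definition Const :: "'a::zero \<Rightarrow> 'a mpol" where
  "Const c = Poly_Mapping.single 0 c"

definition Indet :: "nat \<Rightarrow> 'a::zero_neq_one mpol" where
  "Indet i = Poly_Mapping.single (Poly_Mapping.single i 1) 1"

text \<open>The indeterminate number \<open>0\<close> plays the role of \<open>z\<close>; only \<open>X i\<close> with \<open>i \<ge> 1\<close> is used.\<close>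

abbreviation Z :: "'a::zero_neq_one mpol" where
  "Z \<equiv> Indet 0"

abbreviation X :: "nat \<Rightarrow> 'a::zero_neq_one mpol" where
  "X i \<equiv> Indet i"

text \<open>
  The binomial coefficient \<open>a(a-1)\<cdots>(a-m+1)/m!\<close>, zero for \<open>m < 0\<close>. The library's \<open>gchoose\<close> is
  not available here, since it needs a division on the ring that contains \<open>a\<close>.
\<close>

definition binom :: "'a::field_char_0 mpol \<Rightarrow> int \<Rightarrow> 'a mpol" where
  "binom a m = (if m < 0 then 0
     else Const (1 / fact (nat m)) * (\<Prod>i<nat m. a - of_nat i))"

text \<open>
  A partition is the multiset of its nonzero parts, so that \<open>l(\<mu>)\<close> is \<open>size \<mu>\<close> and
  \<open>m\<^sub>i(\<mu>)\<close> is \<open>count \<mu> i\<close>.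
\<close>

definition partitions :: "nat \<Rightarrow> nat multiset set" where
  "partitions n = {\<mu>. 0 \<notin># \<mu> \<and> sum_mset \<mu> = n}"

lemma finite_partitions: "finite (partitions n)"
proof (rule finite_subset)
  show "partitions n \<subseteq> mset ` {xs. set xs \<subseteq> {..n} \<and> length xs \<le> n}"
  proof
    fix \<mu> assume "\<mu> \<in> partitions n"
    moreover obtain xs where xs: "\<mu> = mset xs" by (metis ex_mset)
    ultimately have 0: "0 \<notin> set xs" and s: "sum_list xs = n"
      by (auto simp: partitions_def sum_mset_sum_list)
    have "set xs \<subseteq> {..n}"
      using s member_le_sum_list by fastforce
    moreover have "0 \<notin> set ys \<Longrightarrow> length ys \<le> sum_list ys" for ys :: "nat list"
      by (induction ys) auto
    ultimately show "\<mu> \<in> mset ` {xs. set xs \<subseteq> {..n} \<and> length xs \<le> n}"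
      using 0 s xs by auto
  qed
  show "finite (mset ` {xs. set xs \<subseteq> {..n} \<and> length xs \<le> n})"
    by (intro finite_imageI finite_lists_length_le) simp
qed

definition z_part :: "nat multiset \<Rightarrow> nat" where
  "z_part \<mu> = (\<Prod>i\<in>set_mset \<mu>. i ^ count \<mu> i * fact (count \<mu> i))"

definition ferrers :: "nat multiset \<Rightarrow> (nat \<times> nat) set" where
  "ferrers \<mu> = {(i, j). i < size \<mu> \<and> j < rev (sorted_list_of_multiset \<mu>) ! i}"

definition gen_binom :: "nat multiset \<Rightarrow> nat \<Rightarrow> nat" where
  "gen_binom \<mu> k =
     card {S. S \<subseteq> ferrers \<mu> \<and> card S = k \<and> (\<forall>i<size \<mu>. \<exists>j. (i, j) \<in> S)}"

lemma finite_ferrers: "finite (ferrers \<mu>)"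
proof (rule finite_subset)
  let ?l = "rev (sorted_list_of_multiset \<mu>)"
  show "ferrers \<mu> \<subseteq> (SIGMA i:{..<size \<mu>}. {..<?l ! i})"
    by (auto simp: ferrers_def)
  show "finite (SIGMA i:{..<size \<mu>}. {..<?l ! i})" by simp
qed

end

theory Submission
  imports Defs "HOL-Library.FuncSet" "HOL-Computational_Algebra.Polynomial"
begin

text \<open>
  Write \<open>h\<^sub>n(a)\<close> for the sum of \<open>(\<Prod>i. a\<^sub>i ^ m\<^sub>i(\<mu>)) / z\<^sub>\<mu>\<close> over the partitions \<open>\<mu>\<close> of \<open>n\<close>, the cycle
  index of the symmetric group. Formally \<open>\<Sum>n. h\<^sub>n(a) t\<^sup>n = exp (\<Sum>i\<ge>1. a\<^sub>i t\<^sup>i / i)\<close>. Choosing cells row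
  by row gives \<open>\<Sum>k. \<langle>\<mu>, k\<rangle> v\<^sup>k = \<Prod>i. ((1 + v)\<^sup>i - 1) ^ m\<^sub>i(\<mu>)\<close>.

  Multiply the left-hand side by \<open>w\<^sup>r t\<^sup>n\<close> and sum over \<open>r\<close> and \<open>n\<close>. With \<open>s = 1 - w\<close> and
  \<open>P\<^sub>i = z + \<Sum>k\<ge>1. u\<^sup>k (i)\<^sub>k / k! x\<^sub>k\<close> the result is \<open>exp (\<Sum>i\<ge>1. (1 - s\<^sup>i) P\<^sub>i t\<^sup>i / i)\<close>. Put
  \<open>q = w t / (1 - t)\<close>, so that \<open>1 + q = (1 - s t) / (1 - t)\<close>. The sums over \<open>i\<close> in the exponent are a
  logarithm and negative powers, and the series becomes
  \<open>(1 + q)\<^sup>z exp (\<Sum>k\<ge>1. b\<^sub>k u\<^sup>k / k)\<close> with \<open>b\<^sub>k = x\<^sub>k ((1 - t) ^ (-k) - (1 - s t) ^ (-k))\<close>. Because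
  \<open>b\<^sub>k = (1 - s t) ^ (-k) x\<^sub>k ((1 + q)\<^sup>k - 1)\<close> and \<open>h\<^sub>j\<close> is homogeneous of weight \<open>j\<close>, the coefficient
  of \<open>u\<^sup>j\<close> is \<open>(1 - t) ^ (-j) (1 + q) ^ (z - j) B\<^sub>j(q)\<close> with \<open>B\<^sub>j(v) = h\<^sub>j(x\<^sub>i ((1 + v)\<^sup>i - 1))\<close>. The
  coefficients of \<open>B\<^sub>j\<close> are the inner sums of the right-hand side, and \<open>(1 - t) ^ (-j) q\<^sup>r\<close> has the
  coefficient \<open>w\<^sup>r binom(n + j - 1, n - r)\<close> at \<open>t\<^sup>n\<close>. This is the right-hand side.

  Exponentials of series in three variables are avoided as follows. The \<open>h\<^sub>n\<close> are determined by the
  recursion \<open>n h\<^sub>n = \<Sum>i=1..n. a\<^sub>i h\<^sub>n\<^sub>-\<^sub>i\<close> (\<open>cycle_index_newton\<close>, \<open>cycle_index_unique\<close>). If \<open>F\<^sub>j\<close> is the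
  claimed coefficient of \<open>u\<^sup>j\<close>, as a series in \<open>t\<close> alone, this recursion for the left-hand side reads
  \<open>t F\<^sub>j' = \<Sum>k=0..j. A\<^sub>k F\<^sub>j\<^sub>-\<^sub>k\<close>, where \<open>A\<^sub>k\<close> collects the coefficients of \<open>u\<^sup>k\<close> in \<open>(1 - s\<^sup>i) P\<^sub>i\<close>. That
  equation (\<open>deriv_F\<close>) follows from the differential equation of \<open>(1 + q)\<^sup>z\<close> and from the action of a
  derivation on \<open>h\<^sub>j\<close> (\<open>cycle_index_deriv\<close>). The variable \<open>w\<close> is an arbitrary element of the coefficient
  ring; an infinite integral domain has enough of them to separate the powers \<open>w\<^sup>r\<close> at the end.
\<close>

unbundle fps_syntax

section \<open>The cycle index and its recursion\<close>

text \<open>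
  The coefficient rings below (polynomials, and power series over them) are not fields, so division by
  positive integers is supplied by a function that inverts them.
\<close>

definition reciprocals :: "(nat \<Rightarrow> 'a::comm_ring_1) \<Rightarrow> bool" where
  "reciprocals c \<longleftrightarrow> (\<forall>n\<ge>1. of_nat n * c n = 1)"

lemma reciprocals_cancel:
  fixes c :: "nat \<Rightarrow> 'a::comm_ring_1"
  assumes "reciprocals c" "n \<ge> 1" and eq: "of_nat n * x = of_nat n * (y::'a)"
  shows "x = y"
proof -
  have c: "of_nat n * c n = 1" using assms(1,2) by (simp add: reciprocals_def)
  have "x = (of_nat n * c n) * x" by (simp add: c)
  also have "\<dots> = c n * (of_nat n * y)" unfolding eq[symmetric] by (simp only: mult_ac)
  also have "\<dots> = (of_nat n * c n) * y" by (simp only: mult_ac)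
  finally show ?thesis by (simp add: c)
qed

lemma reciprocals_fps: "reciprocals c \<Longrightarrow> reciprocals (\<lambda>n. fps_const (c n))"
  by (simp add: reciprocals_def flip: fps_of_nat)

lemma z_part_superset:
  assumes "finite A" "set_mset \<mu> \<subseteq> A"
  shows "z_part \<mu> = (\<Prod>i\<in>A. i ^ count \<mu> i * fact (count \<mu> i))"
  unfolding z_part_def using assms
  by (intro prod.mono_neutral_left) (auto simp: not_in_iff)

text \<open>
  Only the factor of the part size \<open>i\<close> changes when a part \<open>i\<close> is added: it gains one \<open>i\<close> from the power
  and the new multiplicity from the factorial.
\<close>

lemma z_part_add_mset: "z_part (add_mset i \<mu>) = i * count (add_mset i \<mu>) i * z_part \<mu>"
proof -
  let ?A = "insert i (set_mset \<mu>)"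
  let ?f = "\<lambda>\<nu> j. j ^ count \<nu> j * fact (count \<nu> j) :: nat"
  have "z_part (add_mset i \<mu>) = ?f (add_mset i \<mu>) i * (\<Prod>j\<in>?A - {i}. ?f (add_mset i \<mu>) j)"
    by (subst z_part_superset[of ?A]) (auto simp: prod.remove[of ?A i] simp del: prod.insert)
  also have "(\<Prod>j\<in>?A - {i}. ?f (add_mset i \<mu>) j) = (\<Prod>j\<in>?A - {i}. ?f \<mu> j)"
    by (intro prod.cong) auto
  also have "?f (add_mset i \<mu>) i * \<dots> = i * count (add_mset i \<mu>) i * (?f \<mu> i * (\<Prod>j\<in>?A - {i}. ?f \<mu> j))"
    by (simp add: algebra_simps)
  also have "?f \<mu> i * (\<Prod>j\<in>?A - {i}. ?f \<mu> j) = z_part \<mu>"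
    by (subst z_part_superset[of ?A \<mu>]) (auto simp: prod.remove[of ?A i] simp del: prod.insert)
  finally show ?thesis .
qed

lemma z_part_pos:
  assumes "0 \<notin># \<mu>"
  shows "z_part \<mu> \<ge> 1"
proof -
  have "0 < z_part \<mu>"
    unfolding z_part_def
  proof (rule prod_pos)
    fix i assume "i \<in># \<mu>"
    with assms have "i > 0" by (metis neq0_conv)
    thus "0 < i ^ count \<mu> i * fact (count \<mu> i)" by simp
  qed
  thus ?thesis by simp
qed

lemma sum_mset_weighted: "(\<Sum>i\<in>set_mset \<mu>. i * count \<mu> i) = sum_mset (\<mu> :: nat multiset)"
proof -
  have "(\<Sum>i\<in>A. i * count \<mu> i) = sum_mset \<mu>" if "finite A" "set_mset \<mu> \<subseteq> A" for A
    using that(2)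
  proof (induction \<mu>)
    case (add x \<mu>)
    have "(\<Sum>i\<in>A. i * count (add_mset x \<mu>) i) = (\<Sum>i\<in>A. i * count \<mu> i + (if i = x then i else 0))"
      by (intro sum.cong) auto
    with add that(1) show ?case by (simp add: sum.distrib)
  qed simp
  thus ?thesis by simp
qed

definition cycle_index :: "(nat \<Rightarrow> 'a::comm_ring_1) \<Rightarrow> nat \<Rightarrow> (nat \<Rightarrow> 'a) \<Rightarrow> 'a" where
  "cycle_index c n a = (\<Sum>\<mu>\<in>partitions n. c (z_part \<mu>) * (\<Prod>i\<in>#\<mu>. a i))"

lemma partitions_0: "partitions 0 = {{#}}"
  by (auto simp: partitions_def) (metis multiset_nonemptyE)

lemma cycle_index_0: "reciprocals c \<Longrightarrow> cycle_index c 0 a = 1"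
  by (auto simp: cycle_index_def partitions_0 z_part_def reciprocals_def dest: spec[of _ 1])

text \<open>
  Weight each \<open>\<mu>\<close> by \<open>n = \<Sum>i. i m\<^sub>i(\<mu>)\<close> and remove one part \<open>i\<close>: the factor \<open>i m\<^sub>i(\<mu>)\<close> turns
  \<open>1 / z\<^sub>\<mu>\<close> into \<open>1 / z\<^sub>\<nu>\<close> for the remaining partition \<open>\<nu>\<close>. Pairs of a partition and one of its part
  sizes correspond to pairs of a part size and a smaller partition.
\<close>

lemma cycle_index_newton:
  assumes "reciprocals c"
  shows "of_nat n * cycle_index c n a = (\<Sum>i=1..n. a i * cycle_index c (n - i) a)"
proof -
  define M where "M \<mu> = (\<Prod>i\<in>#\<mu>. a i)" for \<mu>
  have "of_nat n * cycle_index c n a = (\<Sum>\<mu>\<in>partitions n. of_nat n * (c (z_part \<mu>) * M \<mu>))"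
    by (simp add: cycle_index_def sum_distrib_left M_def)
  also have "\<dots> = (\<Sum>\<mu>\<in>partitions n. \<Sum>i\<in>set_mset \<mu>. a i * (c (z_part (\<mu> - {#i#})) * M (\<mu> - {#i#})))"
  proof (rule sum.cong)
    fix \<mu> assume "\<mu> \<in> partitions n"
    hence mu: "0 \<notin># \<mu>" "sum_mset \<mu> = n" by (auto simp: partitions_def)
    have "of_nat n * (c (z_part \<mu>) * M \<mu>)
        = (\<Sum>i\<in>set_mset \<mu>. of_nat (i * count \<mu> i) * (c (z_part \<mu>) * M \<mu>))"
      unfolding sum_distrib_right[symmetric] of_nat_sum[symmetric]
      using mu(2) sum_mset_weighted[of \<mu>] by simp
    also have "\<dots> = (\<Sum>i\<in>set_mset \<mu>. a i * (c (z_part (\<mu> - {#i#})) * M (\<mu> - {#i#})))"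
    proof (rule sum.cong)
      fix i assume i: "i \<in># \<mu>"
      define \<nu> where "\<nu> = \<mu> - {#i#}"
      have \<mu>: "\<mu> = add_mset i \<nu>" using i by (simp add: \<nu>_def)
      have "0 \<notin># \<nu>" "i > 0" using mu(1) by (auto simp: \<mu> intro: Nat.gr0I)
      hence pos: "z_part \<nu> \<ge> 1" "z_part \<mu> \<ge> 1" using z_part_pos mu(1) by blast+
      have z: "z_part \<mu> = i * count \<mu> i * z_part \<nu>" by (simp only: \<mu> z_part_add_mset)
      have "of_nat (i * count \<mu> i) * c (z_part \<mu>) = c (z_part \<nu>)"
      proof (rule reciprocals_cancel[OF assms pos(1)])
        have "of_nat (z_part \<nu>) * (of_nat (i * count \<mu> i) * c (z_part \<mu>)) = of_nat (z_part \<mu>) * c (z_part \<mu>)"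
          by (subst (2) z) (simp add: mult_ac)
        also have "\<dots> = of_nat (z_part \<nu>) * c (z_part \<nu>)"
          using assms pos by (simp add: reciprocals_def)
        finally show "of_nat (z_part \<nu>) * (of_nat (i * count \<mu> i) * c (z_part \<mu>)) = \<dots>" .
      qed
      moreover have "M \<mu> = a i * M \<nu>" by (simp add: \<mu> M_def)
      ultimately show "of_nat (i * count \<mu> i) * (c (z_part \<mu>) * M \<mu>) = a i * (c (z_part (\<mu> - {#i#})) * M (\<mu> - {#i#}))"
        unfolding \<nu>_def[symmetric] by (metis mult.assoc mult.left_commute)
    qed simp
    finally show "of_nat n * (c (z_part \<mu>) * M \<mu>) = \<dots>" .
  qed simp
  also have "\<dots> = (\<Sum>(\<mu>, i)\<in>(SIGMA \<mu>:partitions n. set_mset \<mu>). a i * (c (z_part (\<mu> - {#i#})) * M (\<mu> - {#i#})))"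
    by (intro sum.Sigma) (auto simp: finite_partitions)
  also have "\<dots> = (\<Sum>(i, \<nu>)\<in>(SIGMA i:{1..n}. partitions (n - i)). a i * (c (z_part \<nu>) * M \<nu>))"
  proof (rule sum.reindex_bij_witness[where i = "\<lambda>(i, \<nu>). (add_mset i \<nu>, i)" and j = "\<lambda>(\<mu>, i). (i, \<mu> - {#i#})"])
    fix p assume p: "p \<in> (SIGMA \<mu>:partitions n. set_mset \<mu>)"
    obtain \<mu> i where pi: "p = (\<mu>, i)" by (cases p)
    obtain \<nu> where \<mu>: "\<mu> = add_mset i \<nu>" using p pi by (metis SigmaE2 insert_DiffM)
    show "(case p of (\<mu>, i) \<Rightarrow> (i, \<mu> - {#i#})) \<in> (SIGMA i:{1..n}. partitions (n - i))"
      using p by (auto simp: pi \<mu> partitions_def Suc_le_eq intro: Nat.gr0I)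
  qed (auto simp: partitions_def)
  also have "\<dots> = (\<Sum>i=1..n. a i * cycle_index c (n - i) a)"
    by (simp add: sum.Sigma[symmetric] finite_partitions cycle_index_def M_def sum_distrib_left)
  finally show ?thesis .
qed

lemma cycle_index_unique:
  assumes c: "reciprocals c" and "f 0 = 1"
    and rec: "\<And>n. n \<ge> 1 \<Longrightarrow> of_nat n * f n = (\<Sum>i=1..n. a i * f (n - i))"
  shows "f n = cycle_index c n a"
proof (induction n rule: less_induct)
  case (less n)
  show ?case
  proof (cases "n = 0")
    case False
    have "of_nat n * f n = (\<Sum>i=1..n. a i * cycle_index c (n - i) a)"
      using False by (subst rec) (auto simp: less.IH intro!: sum.cong)
    hence "of_nat n * f n = of_nat n * cycle_index c n a"
      by (simp only: cycle_index_newton[OF c])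
    thus ?thesis using False by (metis One_nat_def Suc_leI neq0_conv reciprocals_cancel[OF c])
  qed (simp add: assms(2) cycle_index_0[OF c])
qed

lemma cycle_index_scale: "cycle_index c n (\<lambda>i. l ^ i * a i) = l ^ n * cycle_index c n a"
proof -
  have "(\<Prod>i\<in>#\<mu>. l ^ i * a i) = l ^ sum_mset \<mu> * (\<Prod>i\<in>#\<mu>. a i)" for \<mu>
    by (induction \<mu>) (simp_all add: power_add mult_ac)
  thus ?thesis
    by (simp add: cycle_index_def sum_distrib_left partitions_def mult_ac)
qed

text \<open>
  This is the chain rule for \<open>exp (\<Sum>i\<ge>1. a\<^sub>i t\<^sup>i / i)\<close>, read off at \<open>t\<^sup>n\<close>. Differentiating Newton's
  recursion and using the induction hypothesis gives a double sum whose inner sum is again Newton's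
  recursion, for \<open>n - l\<close>; the weights \<open>l\<close> and \<open>n - l\<close> add up to \<open>n\<close>.
\<close>

lemma cycle_index_deriv:
  assumes c: "reciprocals c"
    and D_add: "\<And>x y. D (x + y) = D x + D y" and D_mult: "\<And>x y. D (x * y) = D x * y + x * D y"
  shows "D (cycle_index c n a) = (\<Sum>i=1..n. c i * D (a i) * cycle_index c (n - i) a)"
proof (induction n rule: less_induct)
  case (less n)
  let ?h = "\<lambda>n. cycle_index c n a"
  have D0: "D 0 = 0" using D_add[of 0 0] by simp
  have D1: "D 1 = 0" using D_mult[of 1 1] by simp
  have D_nat: "D (of_nat m) = 0" for m by (induction m) (simp_all add: D0 D1 D_add)
  have D_sum: "D (\<Sum>i\<in>A. g i) = (\<Sum>i\<in>A. D (g i))" for g and A :: "nat set"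
    by (induction A rule: infinite_finite_induct) (simp_all add: D0 D_add)
  show ?case
  proof (cases "n = 0")
    case False
    have "of_nat n * D (?h n) = D (of_nat n * ?h n)" by (simp add: D_mult D_nat)
    also have "\<dots> = (\<Sum>i=1..n. D (a i) * ?h (n - i)) + (\<Sum>i=1..n. a i * D (?h (n - i)))"
      by (simp add: cycle_index_newton[OF c] D_sum D_mult sum.distrib)
    also have "(\<Sum>i=1..n. a i * D (?h (n - i)))
        = (\<Sum>i=1..n. \<Sum>l=1..n-i. a i * (c l * D (a l) * ?h (n - i - l)))"
      using False by (intro sum.cong) (auto simp: less.IH sum_distrib_left)
    also have "\<dots> = (\<Sum>l=1..n. \<Sum>i=1..n-l. a i * (c l * D (a l) * ?h (n - l - i)))"
      unfolding sum.Sigma[OF finite_atLeastAtMost ballI[OF finite_atLeastAtMost]]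
      by (rule sum.reindex_bij_witness[where i = "\<lambda>(l, i). (i, l)" and j = "\<lambda>(i, l). (l, i)"])
         (auto simp: add.commute)
    also have "\<dots> = (\<Sum>l=1..n. c l * D (a l) * (\<Sum>i=1..n-l. a i * ?h (n - l - i)))"
      by (simp add: sum_distrib_left mult_ac)
    also have "\<dots> = (\<Sum>l=1..n. c l * D (a l) * (of_nat (n - l) * ?h (n - l)))"
      by (simp only: cycle_index_newton[OF c])
    also have "(\<Sum>l=1..n. D (a l) * ?h (n - l)) + \<dots> = (\<Sum>l=1..n. of_nat n * (c l * D (a l) * ?h (n - l)))"
      unfolding sum.distrib[symmetric]
    proof (rule sum.cong)
      fix l assume l: "l \<in> {1..n}"
      have "D (a l) * ?h (n - l) = (of_nat l * c l) * (D (a l) * ?h (n - l))"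
        using c l by (simp add: reciprocals_def)
      moreover have "of_nat n = (of_nat l + of_nat (n - l) :: 'a)"
        using l by (metis atLeastAtMost_iff le_add_diff_inverse of_nat_add)
      ultimately show "D (a l) * ?h (n - l) + c l * D (a l) * (of_nat (n - l) * ?h (n - l))
          = of_nat n * (c l * D (a l) * ?h (n - l))"
        by (simp add: algebra_simps)
    qed simp
    finally have "of_nat n * D (?h n) = of_nat n * (\<Sum>l=1..n. c l * D (a l) * ?h (n - l))"
      by (simp only: sum_distrib_left)
    thus ?thesis
      using False by (metis One_nat_def Suc_leI neq0_conv reciprocals_cancel[OF c])
  qed (simp add: D1 cycle_index_0[OF c])
qed

text \<open>
  The image of the cycle index obeys the same recursion, so the homomorphism need not be checked on
  products over partitions or on the inverses \<open>c\<close>.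
\<close>

lemma cycle_index_hom:
  fixes \<phi> :: "'a::comm_ring_1 \<Rightarrow> 'b::comm_ring_1"
  assumes "\<phi> 1 = 1" "\<And>x y. \<phi> (x + y) = \<phi> x + \<phi> y" "\<And>x y. \<phi> (x * y) = \<phi> x * \<phi> y"
    and c: "reciprocals c" and d: "reciprocals d"
  shows "\<phi> (cycle_index c n a) = cycle_index d n (\<lambda>i. \<phi> (a i))"
proof (rule cycle_index_unique[OF d])
  have 0: "\<phi> 0 = 0" using assms(2)[of 0 0] by simp
  have nat: "\<phi> (of_nat m) = of_nat m" for m by (induction m) (simp_all add: 0 assms)
  have sum: "\<phi> (\<Sum>i\<in>A. g i) = (\<Sum>i\<in>A. \<phi> (g i))" for g and A :: "nat set"
    by (induction A rule: infinite_finite_induct) (simp_all add: 0 assms)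
  show "\<phi> (cycle_index c 0 a) = 1" by (simp add: cycle_index_0[OF c] assms)
  show "of_nat n * \<phi> (cycle_index c n a) = (\<Sum>i = 1..n. \<phi> (a i) * \<phi> (cycle_index c (n - i) a))" for n
  proof -
    have "of_nat n * \<phi> (cycle_index c n a) = \<phi> (of_nat n * cycle_index c n a)"
      by (simp only: assms(3) nat)
    thus ?thesis by (simp only: cycle_index_newton[OF c] sum assms(3))
  qed
qed

section \<open>Row-covering cell choices\<close>

lemma sum_Pow_power_card:
  assumes "finite A"
  shows "(\<Sum>B\<in>Pow A. v ^ card B) = (1 + v :: 'a::comm_ring_1) ^ card A"
proof -
  have "(1 + v) ^ card A = (\<Prod>x\<in>A. v + 1)" by (simp add: add.commute)
  also have "\<dots> = (\<Sum>B\<in>Pow A. v ^ card B)" by (subst prod_add[OF assms]) simp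
  finally show ?thesis ..
qed

lemma ferrers_Sigma:
  "ferrers \<mu> = (SIGMA i:{..<size \<mu>}. {..<rev (sorted_list_of_multiset \<mu>) ! i})"
  by (auto simp: ferrers_def)

lemma prod_rows:
  "(\<Prod>i<size \<mu>. f (rev (sorted_list_of_multiset \<mu>) ! i)) = (\<Prod>i\<in>#\<mu>. f i :: 'a::comm_monoid_mult)"
proof -
  let ?l = "rev (sorted_list_of_multiset \<mu>)"
  have [simp]: "size \<mu> = length ?l" by (metis mset_rev mset_sorted_list_of_multiset size_mset)
  have "(\<Prod>i<size \<mu>. f (?l ! i)) = prod_list (map f ?l)"
    by (simp add: prod.list_conv_set_nth atLeast0LessThan del: length_rev)
  also have "\<dots> = prod_mset (mset (map f ?l))" by (rule prod_mset_prod_list[symmetric])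
  finally show ?thesis by simp
qed

lemma sum_rows: "(\<Sum>i<size \<mu>. rev (sorted_list_of_multiset \<mu>) ! i) = sum_mset \<mu>"
proof -
  let ?l = "rev (sorted_list_of_multiset \<mu>)"
  have [simp]: "size \<mu> = length ?l" by (metis mset_rev mset_sorted_list_of_multiset size_mset)
  have "(\<Sum>i<size \<mu>. ?l ! i) = sum_list ?l"
    by (simp add: sum_list_sum_nth atLeast0LessThan del: length_rev sum_list_rev)
  also have "\<dots> = sum_mset (mset ?l)" by (rule sum_mset_sum_list[symmetric])
  finally show ?thesis by simp
qed

lemma card_ferrers: "card (ferrers \<mu>) = sum_mset \<mu>"
  by (simp add: ferrers_Sigma sum_rows)

text \<open>
  A choice of cells meeting every row is the same as a nonempty subset of each row, and the subsets of
  a row of length \<open>m\<close> have the generating polynomial \<open>(1 + v)\<^sup>m\<close>.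
\<close>

lemma gen_binom_gf:
  "(\<Sum>k\<le>sum_mset \<mu>. of_nat (gen_binom \<mu> k) * v ^ k) = (\<Prod>i\<in>#\<mu>. (1 + v) ^ i - 1 :: 'a::comm_ring_1)"
proof -
  let ?row = "\<lambda>i. {..<rev (sorted_list_of_multiset \<mu>) ! i}"
  let ?I = "{..<size \<mu>}"
  define F where "F = {S. S \<subseteq> ferrers \<mu> \<and> (\<forall>i<size \<mu>. \<exists>j. (i, j) \<in> S)}"
  have "finite F" by (rule finite_subset[of _ "Pow (ferrers \<mu>)"]) (auto simp: F_def finite_ferrers)
  have card_le: "card S \<le> sum_mset \<mu>" if "S \<in> F" for S
    using that card_mono[OF finite_ferrers, of S \<mu>] by (auto simp: F_def card_ferrers)
  have "(\<Sum>k\<le>sum_mset \<mu>. of_nat (gen_binom \<mu> k) * v ^ k) = (\<Sum>k\<le>sum_mset \<mu>. \<Sum>S\<in>{S\<in>F. card S = k}. v ^ card S)"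
  proof (rule sum.cong)
    fix k
    have "{S. S \<subseteq> ferrers \<mu> \<and> card S = k \<and> (\<forall>i<size \<mu>. \<exists>j. (i, j) \<in> S)} = {S\<in>F. card S = k}"
      by (auto simp: F_def)
    thus "of_nat (gen_binom \<mu> k) * v ^ k = (\<Sum>S\<in>{S\<in>F. card S = k}. v ^ card S)"
      by (simp add: gen_binom_def)
  qed simp
  also have "\<dots> = (\<Sum>S\<in>F. v ^ card S)"
    using \<open>finite F\<close> card_le by (intro sum.group) auto
  also have "\<dots> = (\<Sum>T\<in>PiE ?I (\<lambda>i. Pow (?row i) - {{}}). \<Prod>i\<in>?I. v ^ card (T i))"
  proof (rule sum.reindex_bij_witness[where j = "\<lambda>S. \<lambda>i\<in>?I. S `` {i}" and i = "\<lambda>T. Sigma ?I T"])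
    fix S assume S: "S \<in> F"
    show "Sigma ?I (\<lambda>i\<in>?I. S `` {i}) = S"
      using S by (auto simp: F_def ferrers_Sigma)
    show "(\<lambda>i\<in>?I. S `` {i}) \<in> PiE ?I (\<lambda>i. Pow (?row i) - {{}})"
      using S by (fastforce simp: F_def ferrers_Sigma)
    have "S = Sigma ?I (\<lambda>i. S `` {i})" using S by (auto simp: F_def ferrers_Sigma)
    moreover have "finite S" using S finite_subset[OF _ finite_ferrers] by (auto simp: F_def)
    ultimately have "card S = (\<Sum>i\<in>?I. card (S `` {i}))"
      by (metis card_SigmaI finite_Image finite_lessThan)
    thus "(\<Prod>i\<in>?I. v ^ card ((\<lambda>i\<in>?I. S `` {i}) i)) = v ^ card S"
      by (simp add: power_sum)
  next
    fix T assume T: "T \<in> PiE ?I (\<lambda>i. Pow (?row i) - {{}})"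
    show "(\<lambda>i\<in>?I. Sigma ?I T `` {i}) = T"
      using T by (auto simp: fun_eq_iff PiE_iff extensional_def restrict_def)
    show "Sigma ?I T \<in> F"
      using T by (fastforce simp: F_def ferrers_Sigma PiE_iff)
  qed
  also have "\<dots> = (\<Prod>i\<in>?I. \<Sum>B\<in>Pow (?row i) - {{}}. v ^ card B)"
    by (rule prod_sum_PiE[symmetric]) auto
  also have "\<dots> = (\<Prod>i\<in>?I. (1 + v) ^ (rev (sorted_list_of_multiset \<mu>) ! i) - 1)"
    by (simp add: sum_diff1 sum_Pow_power_card)
  also have "\<dots> = (\<Prod>i\<in>#\<mu>. (1 + v) ^ i - 1)"
    by (rule prod_rows)
  finally show ?thesis .
qed

lemma gen_binom_eq_0:
  assumes "k > sum_mset \<mu>"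
  shows "gen_binom \<mu> k = 0"
proof -
  have "card S \<noteq> k" if "S \<subseteq> ferrers \<mu>" for S
    using card_mono[OF finite_ferrers that] assms by (simp add: card_ferrers)
  thus ?thesis unfolding gen_binom_def by (intro card_eq_0_iff[THEN iffD2] disjI1) blast
qed

lemma gen_binom_fps:
  "(\<Prod>i\<in>#\<mu>. (1 + fps_X) ^ i - 1) = Abs_fps (\<lambda>k. of_nat (gen_binom \<mu> k) :: 'a::comm_ring_1)"
proof (rule fps_ext)
  fix k
  have "(\<Prod>i\<in>#\<mu>. (1 + fps_X) ^ i - 1 :: 'a fps) $ k
      = (\<Sum>l\<le>sum_mset \<mu>. of_nat (gen_binom \<mu> l) * (if k = l then 1 else 0))"
    unfolding gen_binom_gf[symmetric] by (simp add: fps_sum_nth flip: fps_of_nat)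
  also have "\<dots> = of_nat (gen_binom \<mu> k)"
    by (simp add: mult_delta_right gen_binom_eq_0)
  finally show "(\<Prod>i\<in>#\<mu>. (1 + fps_X) ^ i - 1 :: 'a fps) $ k = Abs_fps (\<lambda>k. of_nat (gen_binom \<mu> k)) $ k"
    by simp
qed

lemma prod_mset_fps_const: "(\<Prod>i\<in>#\<mu>. fps_const (f i)) = fps_const (\<Prod>i\<in>#\<mu>. f i :: 'a::comm_ring_1)"
  by (induction \<mu>) simp_all

lemma cycle_index_gen_binom_nth:
  "cycle_index (\<lambda>n. fps_const (c n)) j (\<lambda>i. fps_const (x i) * ((1 + fps_X) ^ i - 1)) $ k
     = (\<Sum>\<mu>\<in>partitions j. c (z_part \<mu>) * of_nat (gen_binom \<mu> k) * (\<Prod>i\<in>#\<mu>. x i))"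
  unfolding cycle_index_def prod_mset.distrib prod_mset_fps_const gen_binom_fps fps_sum_nth
    fps_mult_left_const_nth fps_nth_Abs_fps
  by (simp only: mult_ac)

text \<open>
  The signs of the left-hand side of the theorem come from evaluating the generating polynomial at
  \<open>v = -w\<close>.
\<close>

lemma prod_mset_gen_binom:
  fixes w :: "'a::comm_ring_1"
  assumes "sum_mset \<mu> = n"
  shows "(\<Prod>i\<in>#\<mu>. 1 - (1 - w) ^ i) = (\<Sum>r=0..n. w ^ r * ((-1) ^ (r + size \<mu>) * of_nat (gen_binom \<mu> r)))"
proof -
  have "(\<Prod>i\<in>#\<mu>. 1 - (1 - w) ^ i) = (\<Prod>i\<in>#\<mu>. (-1) * ((1 + (- w)) ^ i - 1))" by simp
  also have "\<dots> = (-1) ^ size \<mu> * (\<Prod>i\<in>#\<mu>. (1 + (- w)) ^ i - 1)"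
    unfolding prod_mset.distrib by simp
  also have "\<dots> = (-1) ^ size \<mu> * (\<Sum>r\<le>n. of_nat (gen_binom \<mu> r) * (- w) ^ r)"
    by (simp only: gen_binom_gf[symmetric] assms)
  also have "\<dots> = (\<Sum>r\<le>n. w ^ r * ((-1) ^ (r + size \<mu>) * of_nat (gen_binom \<mu> r)))"
    unfolding sum_distrib_left
    by (intro sum.cong refl) (subst power_minus, simp add: power_add mult_ac)
  finally show ?thesis by (simp add: atLeast0AtMost)
qed

section \<open>Geometric and binomial series\<close>

definition geo :: "'a::comm_ring_1 \<Rightarrow> 'a fps" where
  "geo s = Abs_fps (\<lambda>n. s ^ n)"

lemma geo_inverse: "(1 - fps_const s * fps_X) * geo s = 1"
  by (rule fps_ext) (auto simp: geo_def algebra_simps mult.assoc simp flip: power_Suc)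

text \<open>
  The claimed series, multiplied by \<open>1 - s t\<close>, drops to the previous power by Pascal's rule.
\<close>

lemma geo_power_nth: "(geo s ^ Suc m) $ k = s ^ k * of_nat ((m + k) choose k)"
proof (induction m arbitrary: k)
  case 0
  show ?case by (simp add: geo_def)
next
  case (Suc m)
  define f where "f = Abs_fps (\<lambda>k. s ^ k * of_nat ((Suc m + k) choose k))"
  have "(1 - fps_const s * fps_X) * f = geo s ^ Suc m"
  proof (rule fps_ext)
    fix k
    show "((1 - fps_const s * fps_X) * f) $ k = (geo s ^ Suc m) $ k"
    proof (cases k)
      case (Suc k')
      have "((1 - fps_const s * fps_X) * f) $ k = f $ k - s * f $ k'"
        by (simp add: left_diff_distrib mult.assoc Suc)
      also have "\<dots> = s ^ k * (of_nat ((Suc m + k) choose k) - of_nat ((Suc m + k') choose k'))"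
        by (simp add: f_def Suc algebra_simps)
      also have "(Suc m + k) choose k = ((Suc m + k') choose k') + ((m + k) choose k)"
        by (simp add: Suc)
      finally show ?thesis by (simp add: Suc.IH del: power_Suc)
    qed (simp add: left_diff_distrib mult.assoc f_def Suc.IH del: power_Suc)
  qed
  hence "geo s ^ Suc (Suc m) = geo s * ((1 - fps_const s * fps_X) * f)" by simp
  also have "\<dots> = f" using geo_inverse[of s] by (metis mult.commute mult.assoc mult_1)
  finally show ?case by (simp add: f_def)
qed

lemma reciprocals_mult:
  fixes c :: "nat \<Rightarrow> 'a::comm_ring_1"
  assumes c: "reciprocals c" and "m \<ge> 1" "n \<ge> 1"
  shows "of_nat m * c (m * n) = c n"
proof (rule reciprocals_cancel[OF c \<open>n \<ge> 1\<close>])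
  have "of_nat (m * n) * c (m * n) = 1" "of_nat n * c n = 1"
    using c assms(2,3) unfolding reciprocals_def by (metis One_nat_def Suc_leI mult_pos_pos neq0_conv not_one_le_zero, metis)
  thus "of_nat n * (of_nat m * c (m * n)) = of_nat n * c n" by (simp add: mult_ac)
qed

text \<open>
  The series \<open>(1 + y)\<^sup>a\<close> for an arbitrary ring element \<open>a\<close>.
\<close>

definition binomial_series :: "(nat \<Rightarrow> 'a::comm_ring_1) \<Rightarrow> 'a \<Rightarrow> 'a fps" where
  "binomial_series c a = Abs_fps (\<lambda>r. c (fact r) * (\<Prod>i<r. a - of_nat i))"

lemma binomial_series_Suc:
  assumes "reciprocals c"
  shows "of_nat (Suc r) * binomial_series c a $ Suc r = (a - of_nat r) * binomial_series c a $ r"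
proof -
  have "of_nat (Suc r) * c (fact (Suc r)) = c (fact r)"
    using reciprocals_mult[OF assms, of "Suc r" "fact r"] by (simp add: fact_ge_1)
  thus ?thesis
    by (simp add: binomial_series_def mult_ac del: of_nat_Suc fact_Suc) (metis mult.assoc mult.left_commute)
qed

lemma binomial_series_deriv:
  assumes "reciprocals c"
  shows "(1 + fps_X) * fps_deriv (binomial_series c a) = fps_const a * binomial_series c a"
proof (rule fps_ext)
  fix n
  have "((1 + fps_X) * fps_deriv (binomial_series c a)) $ n
      = of_nat (Suc n) * binomial_series c a $ Suc n + of_nat n * binomial_series c a $ n"
    by (cases n) (simp_all add: distrib_right)
  thus "((1 + fps_X) * fps_deriv (binomial_series c a)) $ n = (fps_const a * binomial_series c a) $ n"
    by (simp only: binomial_series_Suc[OF assms]) (simp add: algebra_simps)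
qed

text \<open>
  Pascal's rule for an indeterminate upper argument. Both sides are multiplied by \<open>r + 1\<close>, after which
  every term is a multiple of the common product \<open>P\<close>.
\<close>

lemma binomial_series_step:
  assumes c: "reciprocals c"
  shows "binomial_series c a = (1 + fps_X) * binomial_series c (a - 1)"
proof (rule fps_ext)
  fix n
  show "binomial_series c a $ n = ((1 + fps_X) * binomial_series c (a - 1)) $ n"
  proof (cases n)
    case (Suc r)
    define P where "P = c (fact r) * (\<Prod>i<r. a - 1 - of_nat i)"
    have f: "of_nat (Suc r) * c (fact (Suc r)) = c (fact r)"
      using reciprocals_mult[OF c, of "Suc r" "fact r"] by (simp add: fact_ge_1)
    have "(\<Prod>i<Suc r. a - of_nat i) = a * (\<Prod>i<r. a - 1 - of_nat i)"
      by (subst prod.lessThan_Suc_shift) (simp add: algebra_simps)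
    hence 1: "of_nat (Suc r) * binomial_series c a $ Suc r = a * P"
      using f by (simp add: binomial_series_def P_def mult_ac del: of_nat_Suc fact_Suc prod.lessThan_Suc)
        (metis mult.assoc mult.left_commute)
    have "of_nat (Suc r) * ((1 + fps_X) * binomial_series c (a - 1)) $ n
        = of_nat (Suc r) * binomial_series c (a - 1) $ Suc r + of_nat (Suc r) * binomial_series c (a - 1) $ r"
      by (simp add: Suc algebra_simps)
    also have "\<dots> = (a - 1 - of_nat r) * P + of_nat (Suc r) * P"
      unfolding binomial_series_Suc[OF c] by (simp add: binomial_series_def P_def)
    also have "\<dots> = a * P" by (simp add: algebra_simps)
    finally have "of_nat (Suc r) * binomial_series c a $ n = of_nat (Suc r) * ((1 + fps_X) * binomial_series c (a - 1)) $ n"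
      using 1 Suc by simp
    thus ?thesis by (rule reciprocals_cancel[OF c, rotated]) simp
  qed (simp add: binomial_series_def)
qed

lemma binomial_series_shift:
  assumes c: "reciprocals c"
  shows "binomial_series c a = (1 + fps_X) ^ j * binomial_series c (a - of_nat j)"
proof (induction j)
  case (Suc j)
  show ?case
    by (subst Suc.IH, subst binomial_series_step[OF c]) (simp add: algebra_simps)
qed simp

lemma fact_choose_pochhammer:
  "fact k * (of_nat ((i + k - 1) choose k) :: 'a::{comm_ring_1, ring_char_0}) = pochhammer (of_nat i) k"
proof -
  have "fact k * ((i + k - 1) choose k) = pochhammer i k"
  proof (induction k)
    case (Suc k)
    show ?case
    proof (cases "i + k")
      case (Suc m)
      have "Suc k * (Suc m choose Suc k) = Suc m * (m choose k)"
        by (simp only: Suc_times_binomial_eq mult.commute)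
      hence "fact (Suc k) * (Suc m choose Suc k) = Suc m * (fact k * (m choose k))"
        unfolding fact_Suc of_nat_id by (simp only: mult.left_commute[of _ "fact k"] mult.assoc)
      moreover have "i + Suc k - 1 = Suc m" "i + k - 1 = m" using Suc by auto
      ultimately have "fact (Suc k) * ((i + Suc k - 1) choose Suc k) = (i + k) * pochhammer i k"
        using Suc.IH Suc by metis
      thus ?thesis by (simp add: pochhammer_Suc mult.commute)
    qed (auto simp: pochhammer_0_left)
  qed simp
  hence "of_nat (fact k * ((i + k - 1) choose k)) = (of_nat (pochhammer i k) :: 'a)" by simp
  thus ?thesis by (simp add: pochhammer_of_nat)
qed

section \<open>The differential equation in \<open>t\<close>\<close>

text \<open>
  The setting for a fixed value of \<open>w\<close>. Power series over \<open>'a\<close> are used with three different variables: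
  \<open>u\<close> in \<open>a\<close>, \<open>t\<close> in \<open>q\<close>, \<open>b\<close>, \<open>G\<close> and \<open>F\<close>, and \<open>y\<close> in series that are composed with \<open>q\<close>. The
  \<open>a i\<close> are the arguments of the cycle index on the left-hand side, and \<open>F j\<close> is the coefficient of
  \<open>u\<^sup>j\<close> on the right-hand side.
\<close>

locale generating_series =
  fixes c :: "nat \<Rightarrow> 'a::{idom, ring_char_0}" and z w :: 'a and x :: "nat \<Rightarrow> 'a"
  assumes c: "reciprocals c"
begin

definition s where "s = 1 - w"

definition q :: "'a fps" where "q = fps_const w * fps_X * geo 1"

definition a :: "nat \<Rightarrow> 'a fps" where
  "a i = fps_const (1 - s ^ i) *
     (fps_const z + Abs_fps (\<lambda>k. if k \<ge> 1 then pochhammer (of_nat i) k * c (fact k) * x k else 0))"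

definition b :: "nat \<Rightarrow> 'a fps" where
  "b i = fps_const (x i) * (geo 1 ^ i - geo s ^ i)"

definition G :: "'a fps" where "G = binomial_series c z oo q"

abbreviation "c' \<equiv> \<lambda>n. fps_const (c n)"

definition F :: "nat \<Rightarrow> 'a fps" where "F j = G * cycle_index c' j b"

lemma c': "reciprocals c'"
  using c by (rule reciprocals_fps)

lemma q_nth_0: "q $ 0 = 0"
  by (simp add: q_def mult.assoc)

lemma geo_1_inverse: "(1 - fps_X) * geo (1::'a) = 1"
  using geo_inverse[of "1::'a"] by simp

lemma geo_s_inverse: "(1 - fps_const s * fps_X) * geo s = 1"
  by (rule geo_inverse)

text \<open>
  The choice of \<open>q\<close> makes \<open>1 + q\<close> the quotient of the two geometric series, so that powers of \<open>1 + q\<close>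
  convert powers of \<open>1 - s t\<close> into powers of \<open>1 - t\<close>.
\<close>

lemma q_geo: "(1 + q) * geo s = geo 1"
proof -
  have "1 + q = (1 - fps_X) * geo 1 + fps_const w * fps_X * geo 1"
    by (simp only: geo_1_inverse q_def)
  also have "\<dots> = (1 - fps_const s * fps_X) * geo 1"
    by (simp add: s_def algebra_simps flip: fps_const_sub)
  finally have "(1 + q) * geo s = geo 1 * ((1 - fps_const s * fps_X) * geo s)" by (simp only: mult_ac)
  thus ?thesis by (simp only: geo_s_inverse mult_1_right)
qed

lemma q_inverse: "(1 + q) * (geo s * (1 - fps_X)) = 1"
  using q_geo geo_1_inverse by (metis mult.assoc mult.commute)

lemma deriv_q: "fps_deriv q = fps_const w * geo 1 ^ 2"
proof -
  have "fps_deriv ((1 - fps_X) * geo (1::'a)) = 0" by (simp add: geo_1_inverse)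
  hence "(1 - fps_X) * fps_deriv (geo (1::'a)) = geo 1" by (simp add: algebra_simps)
  hence d: "fps_deriv (geo (1::'a)) = geo 1 ^ 2"
    using geo_1_inverse unfolding power2_eq_square by (metis mult.assoc mult.commute mult_1)
  have "fps_deriv q = fps_const w * (geo 1 + fps_X * fps_deriv (geo 1))"
    by (simp add: q_def mult.assoc distrib_left)
  also have "geo 1 + fps_X * fps_deriv (geo (1::'a)) = geo 1 * ((1 - fps_X) * geo 1) + fps_X * geo 1 ^ 2"
    by (simp only: geo_1_inverse d mult_1_right)
  also have "\<dots> = geo 1 ^ 2" by (simp add: algebra_simps power2_eq_square)
  finally show ?thesis .
qed

text \<open>
  The series \<open>G = (1 + q)\<^sup>z\<close> has the logarithmic derivative \<open>z q' / (1 + q)\<close>, and \<open>t q' / (1 + q)\<close> is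
  the difference of the two geometric series.
\<close>

lemma deriv_G: "fps_X * fps_deriv G = fps_const z * (geo 1 - geo s) * G"
proof -
  let ?B = "fps_deriv (binomial_series c z) oo q"
  have "((1 + fps_X) * fps_deriv (binomial_series c z)) oo q = fps_const z * G"
    unfolding binomial_series_deriv[OF c]
    by (simp add: fps_compose_mult_distrib[OF q_nth_0] G_def)
  hence B: "(1 + q) * ?B = fps_const z * G"
    by (simp add: fps_compose_mult_distrib[OF q_nth_0] fps_compose_add_distrib q_nth_0)
  have "?B = ((1 + q) * (geo s * (1 - fps_X))) * ?B" by (simp only: q_inverse mult_1)
  also have "\<dots> = geo s * (1 - fps_X) * (fps_const z * G)" by (simp only: B[symmetric] mult_ac)
  finally have B': "?B = \<dots>" .
  have "fps_X * fps_deriv G = fps_X * (?B * (fps_const w * geo 1 ^ 2))"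
    by (simp add: G_def fps_compose_deriv[OF q_nth_0] deriv_q)
  also have "\<dots> = fps_const z * G * (fps_const w * fps_X * geo 1 * geo s) * ((1 - fps_X) * geo 1)"
    unfolding B' by (simp add: algebra_simps power2_eq_square)
  also have "fps_const w * fps_X * geo 1 * geo s = geo 1 - geo s"
    using q_geo by (simp add: q_def algebra_simps)
  finally show ?thesis by (simp only: geo_1_inverse mult_1_right) (simp only: mult_ac)
qed

text \<open>
  The closed form of the sum over \<open>i\<close> that belongs to \<open>u\<^sup>k\<close>. At \<open>t\<^sup>i\<close> it says that
  \<open>i / k binom(k + i - 1, i) = binom(i + k - 1, k) = (i)\<^sub>k / k!\<close>.
\<close>

lemma deriv_b: "k \<ge> 1 \<Longrightarrow> c' k * (fps_X * fps_deriv (b k)) = Abs_fps (\<lambda>i. a i $ k)"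
proof (rule fps_ext)
  fix i assume k: "k \<ge> 1"
  then obtain m where m: "k = Suc m" by (cases k) auto
  have geo: "geo r ^ k $ i = r ^ i * of_nat ((m + i) choose i)" for r :: 'a
    by (simp only: m geo_power_nth)
  have "(c' k * (fps_X * fps_deriv (b k))) $ i = c k * (of_nat i * b k $ i)"
    by (cases i) (simp_all add: mult.assoc)
  also have "b k $ i = x k * ((1 - s ^ i) * of_nat ((m + i) choose i))"
    by (simp add: b_def geo algebra_simps)
  also have "c k * (of_nat i * \<dots>) = (c k * of_nat (i * ((m + i) choose i))) * (1 - s ^ i) * x k"
    by (simp add: mult_ac)
  also have "i * ((m + i) choose i) = k * ((i + k - 1) choose k)"
  proof (cases i)
    case (Suc l)
    have "Suc l * ((m + Suc l) choose Suc l) = (m + Suc l) * ((m + l) choose l)"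
      using Suc_times_binomial_eq[of "m + l" l] by simp
    moreover have "Suc m * ((Suc m + l) choose Suc m) = (Suc m + l) * ((m + l) choose m)"
      using Suc_times_binomial_eq[of "m + l" m] by simp
    moreover have "(m + l) choose l = (m + l) choose m"
      by (metis add_diff_cancel_left' binomial_symmetric le_add1)
    ultimately show ?thesis by (simp add: m Suc add_ac)
  qed (simp add: m)
  also have "c k * of_nat (k * ((i + k - 1) choose k)) = (of_nat k * c k) * of_nat ((i + k - 1) choose k)"
    by (simp add: mult_ac)
  also have "\<dots> = (of_nat (fact k) * c (fact k)) * of_nat ((i + k - 1) choose k)"
    using c k by (simp add: reciprocals_def fact_ge_1 del: of_nat_fact)
  also have "\<dots> = c (fact k) * pochhammer (of_nat i) k"
    by (simp add: fact_choose_pochhammer[symmetric] mult_ac)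
  also have "c (fact k) * pochhammer (of_nat i) k * (1 - s ^ i) * x k = Abs_fps (\<lambda>i. a i $ k) $ i"
    using k by (simp add: a_def)
  finally show "(c' k * (fps_X * fps_deriv (b k))) $ i = Abs_fps (\<lambda>i. a i $ k) $ i" .
qed

lemma a_constant_terms: "Abs_fps (\<lambda>i. a i $ 0) = fps_const z * (geo 1 - geo s)"
  by (rule fps_ext) (simp add: a_def geo_def mult.commute)

text \<open>
  The product rule for \<open>F j = G h\<^sub>j(b)\<close>: the factor \<open>G\<close> contributes the term \<open>k = 0\<close> and the cycle index
  contributes the terms \<open>k \<ge> 1\<close>.
\<close>

lemma deriv_F: "fps_X * fps_deriv (F j) = (\<Sum>k=0..j. Abs_fps (\<lambda>i. a i $ k) * F (j - k))"
proof -
  let ?h = "\<lambda>j. cycle_index c' j b"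
  have "fps_X * fps_deriv (?h j) = (\<Sum>k=1..j. c' k * (fps_X * fps_deriv (b k)) * ?h (j - k))"
    by (rule cycle_index_deriv[OF c', where D = "\<lambda>f. fps_X * fps_deriv f"]) (simp_all add: algebra_simps)
  also have "\<dots> = (\<Sum>k=1..j. Abs_fps (\<lambda>i. a i $ k) * ?h (j - k))"
    by (intro sum.cong) (auto simp: deriv_b)
  finally have h: "fps_X * fps_deriv (?h j) = \<dots>" .
  have "fps_X * fps_deriv (F j) = (fps_X * fps_deriv G) * ?h j + G * (fps_X * fps_deriv (?h j))"
    by (simp add: F_def algebra_simps)
  also have "\<dots> = Abs_fps (\<lambda>i. a i $ 0) * F j + (\<Sum>k=1..j. Abs_fps (\<lambda>i. a i $ k) * F (j - k))"
    unfolding deriv_G h a_constant_terms by (simp add: F_def sum_distrib_left mult_ac)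
  also have "\<dots> = (\<Sum>k=0..j. Abs_fps (\<lambda>i. a i $ k) * F (j - k))"
    by (simp add: sum.atLeast_Suc_atMost)
  finally show ?thesis .
qed

lemma F_nth_0: "F j $ 0 = (if j = 0 then 1 else 0)"
proof -
  have "cycle_index c' j b $ 0 = cycle_index c j (\<lambda>i. b i $ 0)"
    by (rule cycle_index_hom[where \<phi> = "\<lambda>f. f $ 0", OF _ _ _ c' c]) simp_all
  \<comment> \<open>In this form homogeneity evaluates the cycle index of the zero sequence to \<open>0 ^ j\<close>.\<close>
  also have "(\<lambda>i. b i $ 0) = (\<lambda>i. 0 ^ i * 0)"
    by (simp add: b_def geo_def fun_eq_iff fps_power_zeroth)
  also have "cycle_index c j \<dots> = (if j = 0 then 1 else 0)"
    unfolding cycle_index_scale by (simp add: cycle_index_0[OF c])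
  finally have h0: "cycle_index c' j b $ 0 = (if j = 0 then 1 else 0)" .
  have "c 1 = 1" using c by (auto simp: reciprocals_def dest: spec[of _ 1])
  thus ?thesis by (simp add: F_def G_def binomial_series_def h0)
qed

text \<open>
  The coefficient of \<open>t\<^sup>n\<close> in \<open>deriv_F\<close>, for all \<open>j\<close> at once, is Newton's recursion in the ring of series
  in \<open>u\<close>.
\<close>

lemma cycle_index_a: "cycle_index c' n a = Abs_fps (\<lambda>j. F j $ n)"
proof (rule cycle_index_unique[OF c', symmetric])
  show "Abs_fps (\<lambda>j. F j $ 0) = 1"
    by (rule fps_ext) (simp add: F_nth_0)
  fix n
  show "of_nat n * Abs_fps (\<lambda>j. F j $ n) = (\<Sum>i=1..n. a i * Abs_fps (\<lambda>j. F j $ (n - i)))"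
  proof (rule fps_ext)
    fix j
    have "(of_nat n * Abs_fps (\<lambda>j. F j $ n)) $ j = of_nat n * F j $ n"
      by (simp flip: fps_of_nat)
    also have "\<dots> = (fps_X * fps_deriv (F j)) $ n" by (cases n) simp_all
    also have "\<dots> = (\<Sum>k=0..j. \<Sum>i=0..n. a i $ k * F (j - k) $ (n - i))"
      by (simp add: deriv_F fps_sum_nth fps_mult_nth)
    also have "\<dots> = (\<Sum>k=0..j. \<Sum>i=1..n. a i $ k * F (j - k) $ (n - i))"
      by (simp add: sum.atLeast_Suc_atMost a_def)
    also have "\<dots> = (\<Sum>i=1..n. \<Sum>k=0..j. a i $ k * F (j - k) $ (n - i))"
      by (rule sum.swap)
    finally show "(of_nat n * Abs_fps (\<lambda>j. F j $ n)) $ j = (\<Sum>i=1..n. a i * Abs_fps (\<lambda>j. F j $ (n - i))) $ j"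
      by (simp add: fps_sum_nth fps_mult_nth)
  qed
qed

text \<open>
  The power \<open>(1 - s t) ^ (-j)\<close> that homogeneity pulls out of the cycle index combines with \<open>(1 + q)\<^sup>j\<close>,
  split off from \<open>G\<close>, to \<open>(1 - t) ^ (-j)\<close>. What remains is a series in \<open>q\<close>.
\<close>

lemma F_factorization:
  "F j = geo 1 ^ j *
     ((binomial_series c (z - of_nat j) * cycle_index c' j (\<lambda>i. fps_const (x i) * ((1 + fps_X) ^ i - 1))) oo q)"
    (is "_ = _ * ((?B * ?h) oo q)")
proof -
  have 1: "(1 + fps_X) ^ i oo q = (1 + q) ^ i" for i
    by (simp add: fps_compose_power[OF q_nth_0, symmetric] fps_compose_add_distrib q_nth_0)
  have G: "G = (1 + q) ^ j * (?B oo q)"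
    by (simp add: G_def binomial_series_shift[OF c, of z j] fps_compose_mult_distrib[OF q_nth_0] 1)
  have "b = (\<lambda>i. geo s ^ i * (fps_const (x i) * ((1 + q) ^ i - 1)))"
  proof
    fix i
    have "b i = fps_const (x i) * (((1 + q) * geo s) ^ i - geo s ^ i)"
      by (simp only: b_def q_geo)
    thus "b i = geo s ^ i * (fps_const (x i) * ((1 + q) ^ i - 1))"
      unfolding power_mult_distrib by (simp add: algebra_simps)
  qed
  hence "cycle_index c' j b = geo s ^ j * cycle_index c' j (\<lambda>i. fps_const (x i) * ((1 + q) ^ i - 1))"
    by (simp only: cycle_index_scale)
  also have "(\<lambda>i. fps_const (x i) * ((1 + q) ^ i - 1)) = (\<lambda>i. (fps_const (x i) * ((1 + fps_X) ^ i - 1)) oo q)"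
    by (simp add: fps_compose_mult_distrib[OF q_nth_0] fps_compose_sub_distrib 1)
  also have "cycle_index c' j \<dots> = ?h oo q"
    by (rule cycle_index_hom[where \<phi> = "\<lambda>f. f oo q", symmetric, OF _ _ _ c' c'])
       (simp_all add: fps_compose_mult_distrib[OF q_nth_0] fps_compose_add_distrib)
  finally have "F j = ((1 + q) * geo s) ^ j * ((?B oo q) * (?h oo q))"
    by (simp add: F_def G power_mult_distrib mult_ac)
  thus ?thesis by (simp add: q_geo fps_compose_mult_distrib[OF q_nth_0])
qed

lemma geo_compose_nth:
  "(geo 1 ^ j * (f oo q)) $ n = (\<Sum>r=0..n. w ^ r * geo 1 ^ (r + j) $ (n - r) * f $ r)"
proof -
  have p: "geo 1 ^ j * q ^ r = fps_const (w ^ r) * (fps_X ^ r * geo 1 ^ (r + j))" for r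
    by (simp add: q_def power_mult_distrib power_add mult_ac flip: fps_const_power)
  have q: "q ^ r $ m = 0" if "m < r" for r m
    by (simp add: q_def power_mult_distrib mult.assoc fps_X_power_mult_nth that flip: fps_const_power)
      (simp add: that fps_X_power_mult_nth fps_const_power)
  have "(geo 1 ^ j * (f oo q)) $ n = (\<Sum>i=0..n. geo 1 ^ j $ i * (\<Sum>r=0..n-i. f $ r * q ^ r $ (n - i)))"
    by (simp add: fps_mult_nth fps_compose_nth)
  also have "\<dots> = (\<Sum>i=0..n. geo 1 ^ j $ i * (\<Sum>r=0..n. f $ r * q ^ r $ (n - i)))"
    by (intro sum.cong refl arg_cong2[where f = "(*)"] sum.mono_neutral_left) (auto simp: q)
  also have "\<dots> = (\<Sum>i=0..n. \<Sum>r=0..n. f $ r * (geo 1 ^ j $ i * q ^ r $ (n - i)))"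
    by (simp add: sum_distrib_left mult_ac)
  also have "\<dots> = (\<Sum>r=0..n. f $ r * (geo 1 ^ j * q ^ r) $ n)"
    by (subst sum.swap) (simp add: fps_mult_nth sum_distrib_left)
  also have "\<dots> = (\<Sum>r=0..n. w ^ r * geo 1 ^ (r + j) $ (n - r) * f $ r)"
    unfolding p by (intro sum.cong) (auto simp: fps_X_power_mult_nth mult_ac)
  finally show ?thesis .
qed

lemma cycle_index_a_nth:
  "cycle_index c' n a $ j = (\<Sum>r=0..n. w ^ r * (geo 1 ^ (r + j) $ (n - r) *
     (binomial_series c (z - of_nat j) * cycle_index c' j (\<lambda>i. fps_const (x i) * ((1 + fps_X) ^ i - 1))) $ r))"
  by (simp add: cycle_index_a F_factorization geo_compose_nth mult.assoc)

end

section \<open>Extracting coefficients\<close>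

text \<open>
  Over an integral domain of characteristic zero a polynomial function determines its coefficients.
  This replaces a formal variable \<open>w\<close>.
\<close>

lemma poly_identity:
  fixes f g :: "nat \<Rightarrow> 'a::{idom, ring_char_0}"
  assumes "\<And>w. (\<Sum>r=0..n. w ^ r * f r) = (\<Sum>r=0..n. w ^ r * g r)" and "r \<le> n"
  shows "f r = g r"
proof -
  let ?p = "\<lambda>f. \<Sum>r=0..n. monom (f r) r :: 'a poly"
  have "poly (?p f) = poly (?p g)"
    using assms(1) by (simp add: fun_eq_iff poly_sum poly_monom mult.commute)
  hence "coeff (?p f) r = coeff (?p g) r" by (simp only: poly_eq_poly_eq_iff)
  with \<open>r \<le> n\<close> show ?thesis by (simp add: coeff_sum)
qed

text \<open>
  The theorem over any suitable ring, at a single power of \<open>u\<close> and with \<open>binom(n + j - 1, n - r)\<close> still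
  written as a coefficient of a power of the geometric series.
\<close>

lemma coefficient_identity:
  fixes c x :: "nat \<Rightarrow> 'a::{idom, ring_char_0}" and z :: 'a
  assumes c: "reciprocals c" and "r \<le> n"
  defines "P \<equiv> \<lambda>i. fps_const z + Abs_fps (\<lambda>k. if k \<ge> 1 then pochhammer (of_nat i) k * c (fact k) * x k else 0)"
  shows "(\<Sum>\<mu>\<in>partitions n. fps_const ((-1) ^ (r + size \<mu>) * c (z_part \<mu>) * of_nat (gen_binom \<mu> r))
            * (\<Prod>i\<in>#\<mu>. P i)) $ j
       = geo 1 ^ (r + j) $ (n - r) * (\<Sum>k=0..min r j. binomial_series c (z - of_nat j) $ (r - k) *
            (\<Sum>\<mu>\<in>partitions j. c (z_part \<mu>) * of_nat (gen_binom \<mu> k) * (\<Prod>i\<in>#\<mu>. x i)))"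
proof -
  define L where "L r = (\<Sum>\<mu>\<in>partitions n. fps_const ((-1) ^ (r + size \<mu>) * c (z_part \<mu>) * of_nat (gen_binom \<mu> r))
            * (\<Prod>i\<in>#\<mu>. P i)) $ j" for r
  define h where "h k = (\<Sum>\<mu>\<in>partitions j. c (z_part \<mu>) * of_nat (gen_binom \<mu> k) * (\<Prod>i\<in>#\<mu>. x i))" for k
  define B where "B = binomial_series c (z - of_nat j)"
  have "L r = geo 1 ^ (r + j) $ (n - r) * (\<Sum>k=0..r. B $ (r - k) * h k)"
  proof (rule poly_identity[OF _ \<open>r \<le> n\<close>])
    fix w :: 'a
    interpret generating_series c z w x by unfold_locales (rule c)
    have a: "a i = fps_const (1 - (1 - w) ^ i) * P i" for i
      by (simp only: a_def P_def s_def)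
    have "(\<Sum>r=0..n. w ^ r * L r) = (\<Sum>\<mu>\<in>partitions n. \<Sum>r=0..n.
        w ^ r * ((-1) ^ (r + size \<mu>) * of_nat (gen_binom \<mu> r)) * (c (z_part \<mu>) * (\<Prod>i\<in>#\<mu>. P i) $ j))"
      unfolding L_def fps_sum_nth sum_distrib_left by (subst sum.swap) (simp add: mult_ac)
    also have "\<dots> = (\<Sum>\<mu>\<in>partitions n. (\<Prod>i\<in>#\<mu>. 1 - (1 - w) ^ i) * (c (z_part \<mu>) * (\<Prod>i\<in>#\<mu>. P i) $ j))"
      unfolding sum_distrib_right[symmetric]
      by (intro sum.cong) (auto simp: prod_mset_gen_binom[of _ n] partitions_def)
    also have "\<dots> = cycle_index c' n a $ j"
      unfolding cycle_index_def a prod_mset.distrib prod_mset_fps_const fps_sum_nth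
        fps_mult_left_const_nth
      by (simp only: mult.assoc fps_mult_left_const_nth mult.left_commute)
    also have "\<dots> = (\<Sum>r=0..n. w ^ r * (geo 1 ^ (r + j) $ (n - r) * (\<Sum>k=0..r. B $ (r - k) * h k)))"
      unfolding cycle_index_a_nth B_def[symmetric] mult.commute[of B] fps_mult_nth cycle_index_gen_binom_nth h_def
      by (simp add: mult.commute)
    finally show "(\<Sum>r=0..n. w ^ r * L r) = \<dots>" .
  qed
  also have "(\<Sum>k=0..r. B $ (r - k) * h k) = (\<Sum>k=0..min r j. B $ (r - k) * h k)"
    by (rule sum.mono_neutral_right) (auto simp: h_def partitions_def gen_binom_eq_0 intro!: sum.neutral)
  finally show ?thesis unfolding L_def h_def B_def .
qed

section \<open>Specialization to the polynomial ring\<close>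

lemma Const_mult: "Const (a * b) = Const a * (Const b :: 'a::comm_ring_1 mpol)"
  by (simp add: Const_def mult_single)

lemma Const_diff: "Const (a - b) = Const a - (Const b :: 'a::comm_ring_1 mpol)"
  by (simp add: Const_def single_diff)

lemma Const_1: "Const 1 = (1 :: 'a::comm_ring_1 mpol)"
  by (simp add: Const_def)

lemma Const_of_nat: "Const (of_nat n) = (of_nat n :: 'a::comm_ring_1 mpol)"
  by (simp add: Const_def)

lemma Const_uminus_power: "Const ((-1) ^ n) = ((-1) ^ n :: 'a::comm_ring_1 mpol)"
  by (cases "even n") (simp_all add: Const_def single_uminus)

lemma Const_prod: "Const (\<Prod>i\<in>A. f i) = (\<Prod>i\<in>A. Const (f i) :: 'a::comm_ring_1 mpol)"
  by (induction A rule: infinite_finite_induct) (simp_all add: Const_1 Const_mult)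

lemma binom_of_nat: "binom (of_nat N) (int k) = (of_nat (N choose k) :: 'a::field_char_0 mpol)"
proof -
  have "binom (of_nat N) (int k) = (Const (1 / fact k * (\<Prod>i<k. of_nat N - of_nat i)) :: 'a mpol)"
    unfolding Const_mult Const_prod Const_diff Const_of_nat by (simp add: binom_def)
  also have "1 / fact k * (\<Prod>i<k. of_nat N - of_nat i) = (of_nat (N choose k) :: 'a)"
    by (simp add: binomial_gbinomial gbinomial_prod_rev atLeast0LessThan)
  finally show ?thesis by (simp only: Const_of_nat)
qed

lemma minus_one_powi: "(-1 :: 'a::field) powi (int r - int l) = (-1) ^ (r + l)"
proof -
  have "(-1 :: 'a) powi (int r - int l) = (-1) powi int r / (-1) powi int l"
    by (rule power_int_diff) simp
  also have "\<dots> = (-1) ^ r / (-1) ^ l" by (simp only: power_int_of_nat)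
  also have "\<dots> = (-1) ^ r * (-1) ^ l" by (cases "even l") simp_all
  finally show ?thesis by (simp only: power_add)
qed

theorem mainTheorem5:
  fixes n r :: nat
  assumes "n \<ge> 1" and "r \<ge> 1"
  shows
    "(\<Sum>\<mu>\<in>partitions n.
        fps_const (Const ((-1) powi (int r - int (size \<mu>)) / of_nat (z_part \<mu>)
                          * of_nat (gen_binom \<mu> r)))
        * (\<Prod>i\<in>set_mset \<mu>.
             (fps_const Z
              + Abs_fps (\<lambda>k. if k \<ge> 1 then Const (pochhammer (of_nat i) k / fact k) * X k else 0))
             ^ count \<mu> i))
     = (Abs_fps (\<lambda>j.
          binom (of_int (int n + int j - 1)) (int n - int r)
          * (\<Sum>k = 0..min r j.
               binom (Z - of_nat j) (int r - int k)
               * (\<Sum>\<mu>\<in>partitions j.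
                    Const (of_nat (gen_binom \<mu> k) / of_nat (z_part \<mu>))
                    * (\<Prod>i\<in>set_mset \<mu>. X i ^ count \<mu> i))))
        :: 'a::field_char_0 mpol fps)"
  (is "?L = ?R")
proof (cases "r \<le> n")
  case False
  \<comment> \<open>A diagram with \<open>n\<close> cells has no \<open>r\<close> of them to choose, and \<open>n - r\<close> is a negative lower index.\<close>
  hence "?L = 0"
    by (intro sum.neutral) (auto simp: gen_binom_eq_0 partitions_def Const_def)
  moreover have "?R = 0"
    using False by (intro fps_ext) (simp add: binom_def)
  ultimately show ?thesis by simp
next
  case True
  define c :: "nat \<Rightarrow> 'a mpol" where "c n = Const (1 / of_nat n)" for n
  have c: "reciprocals c"
    unfolding reciprocals_def c_def Const_of_nat[symmetric] Const_mult[symmetric] by (simp add: Const_1)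
  define P :: "nat \<Rightarrow> 'a mpol fps" where
    "P i = fps_const Z + Abs_fps (\<lambda>k. if k \<ge> 1 then pochhammer (of_nat i) k * c (fact k) * X k else 0)" for i
  have "Const (pochhammer (of_nat i) k / fact k) = (pochhammer (of_nat i) k * c (fact k) :: 'a mpol)" for i k
  proof -
    have "Const (pochhammer (of_nat i) k / fact k) = Const (of_nat (pochhammer i k)) * (c (fact k) :: 'a mpol)"
      unfolding c_def Const_mult[symmetric] by (simp add: pochhammer_of_nat)
    thus ?thesis by (simp only: Const_of_nat pochhammer_of_nat)
  qed
  hence P: "fps_const Z + Abs_fps (\<lambda>k. if k \<ge> 1 then Const (pochhammer (of_nat i) k / fact k) * X k else 0) = P i" for i
    by (simp only: P_def)
  have L: "Const ((-1) powi (int r - int (size \<mu>)) / of_nat (z_part \<mu>) * of_nat (gen_binom \<mu> r))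
      = (-1) ^ (r + size \<mu>) * c (z_part \<mu>) * of_nat (gen_binom \<mu> r)" for \<mu>
    unfolding c_def Const_of_nat[symmetric] Const_uminus_power[symmetric] Const_mult[symmetric]
    by (simp add: minus_one_powi)
  have R: "Const (of_nat (gen_binom \<mu> k) / of_nat (z_part \<mu>)) = c (z_part \<mu>) * of_nat (gen_binom \<mu> k)" for \<mu> k
    unfolding c_def Const_of_nat[symmetric] Const_mult[symmetric] by simp
  have B: "binomial_series c (Z - of_nat j) $ (r - k) = binom (Z - of_nat j) (int r - int k)"
    if "k \<le> r" for j k
    using that by (simp add: binomial_series_def binom_def c_def nat_diff_distrib)
  have G: "geo 1 ^ (r + j) $ (n - r) = (binom (of_int (int n + int j - 1)) (int n - int r) :: 'a mpol)" for j
  proof -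
    obtain m where m: "r + j = Suc m" using \<open>r \<ge> 1\<close> by (cases "r + j") auto
    have N: "m + (n - r) = n + j - 1" using m True by simp
    have "of_int (int n + int j - 1) = (of_nat (n + j - 1) :: 'a mpol)"
      using \<open>n \<ge> 1\<close> by (simp add: of_nat_diff)
    hence "binom (of_int (int n + int j - 1)) (int n - int r) = (of_nat ((n + j - 1) choose (n - r)) :: 'a mpol)"
      using True binom_of_nat[of "n + j - 1" "n - r"] by (simp only: of_nat_diff)
    thus ?thesis by (simp only: m geo_power_nth power_one mult_1 N)
  qed
  show ?thesis
    using coefficient_identity[OF c True, of Z X]
    unfolding P L R by (intro fps_ext) (simp add: G B P_def image_prod_mset_multiplicity)
qed

end
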